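(* Let $a$ be a positive integer that is not a perfect cube, let $p$ be a prime with $p>a^2+2a$, and let $n=ap^3+1$. If there exists an integer $b$ such that $b^{n-1}\equiv 1\pmod n$ and $b^a\not\equiv 1\pmod n$, then $n$ is prime. *)

theory Defs
  imports
    "HOL-Number_Theory.Number_Theory"
    "HOL-Computational_Algebra.Nth_Powers"
begin

end

theory Submission
  imports Defs
begin

text \<open>
  Since the order of \<open>b\<close> modulo \<open>n\<close> divides \<open>a p\<^sup>3\<close> but not \<open>a\<close>, it is divisible by \<open>p\<close>; hence
  \<open>p\<close> divides \<open>\<phi>(n)\<close>, and as \<open>p\<close> does not divide \<open>n\<close>, some prime factor of \<open>n\<close> is congruent to
  \<open>1\<close> modulo \<open>p\<close>. If \<open>n\<close> is composite, the cofactor is congruent to \<open>1\<close> as well, so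
  \<open>n = (1 + x p) (1 + y p)\<close> with \<open>x \<ge> y \<ge> 1\<close>. Comparing with \<open>a p\<^sup>3 + 1\<close> gives \<open>x + y = k p\<close> and
  \<open>x y = a p - k\<close>, whence \<open>p (k y - a) = y\<^sup>2 - k\<close> and \<open>k y < 2 a\<close>. Size estimates force both sides
  to vanish, and then \<open>a = y\<^sup>3\<close>.
\<close>

lemma prime_dvd_ord_of_dvd_mult_power:
  fixes a b e n p :: nat
  assumes "prime p" "[b ^ (a * p ^ e) = 1] (mod n)" "\<not> [b ^ a = 1] (mod n)"
  shows "p dvd ord n b"
proof (rule ccontr)
  assume "\<not> p dvd ord n b"
  then have "coprime (ord n b) (p ^ e)"
    using assms(1) by (simp add: coprime_commute prime_imp_coprime)
  moreover have "ord n b dvd a * p ^ e"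
    using assms(2) ord_divides by blast
  ultimately have "ord n b dvd a"
    by (simp add: coprime_dvd_mult_left_iff)
  then show False
    using assms(3) ord_divides by blast
qed

text \<open>In the product formula for the totient, \<open>p\<close> cannot divide a power of a
  prime factor \<open>q\<close>: that would force \<open>q = p\<close>, but \<open>p\<close> does
  not divide \<open>n\<close>. So it divides some \<open>q - 1\<close>.\<close>

lemma prime_dvd_totientE:
  fixes n p :: nat
  assumes "prime p" "\<not> p dvd n" "n > 0" "p dvd totient n"
  obtains q where "prime q" "q dvd n" "p dvd q - 1"
proof -
  have "p dvd (\<Prod>q\<in>prime_factors n. q ^ (multiplicity q n - 1) * (q - 1))"
    using assms(4) totient_formula1[OF assms(3)] by simp
  then obtain q where q: "q \<in> prime_factors n" "p dvd q ^ (multiplicity q n - 1) * (q - 1)"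
    using assms(1) by (auto simp: prime_dvd_prod_iff)
  have "\<not> p dvd q ^ (multiplicity q n - 1)"
    using q(1) assms(1,2) by (metis in_prime_factors_iff prime_dvd_power primes_dvd_imp_eq)
  then have "p dvd q - 1"
    using q(2) assms(1) prime_dvd_mult_iff by blast
  with q(1) that show thesis by (auto simp: in_prime_factors_iff)
qed

lemma cube_if_factors_cong_1:
  fixes a p x y :: int
  assumes "1 \<le> y" "y \<le> x" "a > 0" "p > a\<^sup>2 + 2 * a"
    and eq: "(1 + x * p) * (1 + y * p) = a * p ^ 3 + 1"
  shows "a = y ^ 3"
proof -
  have p: "p > 0" using assms(3,4) by (smt (verit) zero_le_power2)
  have "p * (x + y + x * y * p) = p * (a * p\<^sup>2)"
    using eq by (simp add: algebra_simps power2_eq_square power3_eq_cube)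
  then have sum: "x + y + x * y * p = a * p\<^sup>2" using p by simp
  then have "x + y = p * (a * p - x * y)"
    by (simp add: algebra_simps power2_eq_square)
  then obtain k where k: "x + y = p * k" "k = a * p - x * y" by blast
  have "k > 0" using k(1) assms(1,2) p by (smt (verit) zero_less_mult_pos)
  have x: "x = p * k - y" using k(1) by simp
  have key: "p * (k * y - a) = y\<^sup>2 - k"
    using k(2) unfolding x by (simp add: algebra_simps power2_eq_square)
  \<comment> \<open>From \<open>y \<le> x\<close>, \<open>p * k = x + y\<close> is at most
    \<open>2 * x\<close>; then \<open>x * y = a * p - k < a * p\<close> bounds
    \<open>k * y\<close>.\<close>
  have "p * (k * y) \<le> 2 * (x * y)"
  proof -
    have "(p * k) * y \<le> (2 * x) * y"
      using k(1) assms(1,2) by (intro mult_right_mono) auto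
    then show ?thesis by (simp add: algebra_simps)
  qed
  also have "\<dots> < p * (2 * a)" using k(2) \<open>k > 0\<close> by (simp add: algebra_simps)
  finally have ky: "k * y < 2 * a" using p by simp
  define t where "t = k * y - a"
  have t: "p * t = y\<^sup>2 - k" "k * y = a + t" "t < a" using key ky by (auto simp: t_def)
  have "k \<le> a + t" using t(2) assms(1) \<open>k > 0\<close> by (smt (verit) mult_le_cancel_left1)
  have "y \<le> a + t" using t(2) assms(1) \<open>k > 0\<close> by (smt (verit) mult_le_cancel_right1)
  have "t = 0"
  proof (rule ccontr)
    assume "t \<noteq> 0"
    then consider "t \<ge> 1" | "t \<le> -1" by linarith
    then show False
    proof cases
      case 1
      \<comment> \<open>Here \<open>p * t\<close> is squeezed below
        \<open>(a + t)\<^sup>2 - 1\<close>. The difference of the outer terms factors, and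
        \<open>t + 1 \<le> a \<le> a\<^sup>2\<close> gives the wrong sign.\<close>
      have "(a\<^sup>2 + 2 * a) * t < p * t" using 1 assms(4) by simp
      also have "\<dots> \<le> (a + t)\<^sup>2 - 1"
        using t(1) \<open>k > 0\<close> power_mono[OF \<open>y \<le> a + t\<close>, of 2] assms(1) by simp
      finally have "(t - 1) * (a\<^sup>2 - (t + 1)) < 0"
        by (simp add: algebra_simps power2_eq_square)
      moreover have "a\<^sup>2 \<ge> t + 1"
        using t(3) assms(3) self_le_power[of a 2] by simp
      ultimately show False using 1 by (smt (verit) mult_nonneg_nonneg)
    next
      case 2
      \<comment> \<open>Now \<open>y\<^sup>2 - k \<le> -p\<close> makes \<open>k\<close> at least
        \<open>p\<close>, although \<open>k \<le> a + t < 2 * a < p\<close>.\<close>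
      have "p * t \<le> p * (- 1)" using 2 p by (intro mult_left_mono) auto
      then have "p \<le> k" using t(1) by (smt (verit) zero_le_power2)
      then show False
        using \<open>k \<le> a + t\<close> t(3) assms(3,4) by (smt (verit) zero_le_power2)
    qed
  qed
  \<comment> \<open>With \<open>t = 0\<close>, \<open>k = y\<^sup>2\<close> and
    \<open>k * y = a\<close>.\<close>
  then show ?thesis using t by (simp add: power2_eq_square power3_eq_cube)
qed

theorem theorem4p5:
  fixes a p n :: nat
  assumes "a > 0"
    and "\<not> is_nth_power 3 a"
    and "prime p"
    and "p > a\<^sup>2 + 2 * a"
    and "n = a * p ^ 3 + 1"
    and "\<exists>b::int. [b ^ (n - 1) = 1] (mod int n) \<and> \<not> [b ^ a = 1] (mod int n)"
  shows "prime n"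
proof (rule ccontr)
  assume "\<not> prime n"
  have n: "n > 1" using assms(1,3,5) prime_gt_0_nat by simp
  obtain b :: int where b: "[b ^ (n - 1) = 1] (mod int n)" "\<not> [b ^ a = 1] (mod int n)"
    using assms(6) by blast
  \<comment> \<open>The order and totient facts are used over the naturals, so \<open>b\<close> is
    replaced by its least nonnegative residue.\<close>
  define c where "c = nat (b mod int n)"
  have c: "[c ^ j = 1] (mod n) \<longleftrightarrow> [b ^ j = 1] (mod int n)" for j
  proof -
    have "int c = b mod int n" using n by (simp add: c_def)
    then show ?thesis
      by (simp add: cong_int_iff[symmetric] cong_def power_mod)
  qed
  have c1: "[c ^ (a * p ^ 3) = 1] (mod n)" using b(1) c assms(5) by simp
  have "coprime (c ^ (a * p ^ 3)) n"
    using cong_imp_coprime[OF cong_sym[OF c1]] by simp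
  then have "coprime n c"
    using assms(1,3) by (auto simp: coprime_commute)
  have "p dvd ord n c"
    using prime_dvd_ord_of_dvd_mult_power[OF assms(3) c1] b(2) c by simp
  then have "p dvd totient n"
    using order_divides_totient[OF \<open>coprime n c\<close>] by (rule dvd_trans)
  moreover have "\<not> p dvd n"
  proof
    assume "p dvd n"
    moreover have "p dvd a * p ^ 3" by simp
    ultimately have "p dvd 1" using assms(5) dvd_add_right_iff by blast
    then show False using assms(3) by auto
  qed
  ultimately obtain q where q: "prime q" "q dvd n" "p dvd q - 1"
    using prime_dvd_totientE[OF assms(3)] n by (metis less_trans zero_less_one)
  from q(3) obtain x where "q - 1 = p * x" ..
  then have x: "q = 1 + x * p" using prime_gt_1_nat[OF q(1)] by (simp add: algebra_simps)
  from q(2) obtain m where m: "n = q * m" ..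
  have "m > 1" using m n q(1) \<open>\<not> prime n\<close> by (cases m; cases "m = 1") auto
  \<comment> \<open>Both \<open>q\<close> and \<open>n = q * m\<close> are 1 modulo
    \<open>p\<close>, hence so is \<open>m\<close>.\<close>
  have "p dvd m - 1"
  proof -
    have "m + p * (x * m) = p * (a * p\<^sup>2) + 1"
      using m x assms(5) by (simp add: algebra_simps power2_eq_square power3_eq_cube)
    then have "(m - 1) + p * (x * m) = p * (a * p\<^sup>2)" using \<open>m > 1\<close> by linarith
    then show ?thesis by (metis dvd_add_left_iff dvd_triv_left)
  qed
  then obtain y where "m - 1 = p * y" ..
  then have y: "m = 1 + y * p" using \<open>m > 1\<close> by (simp add: algebra_simps)
  have pos: "x \<ge> 1" "y \<ge> 1" using x y \<open>m > 1\<close> prime_gt_1_nat[OF q(1)] by (auto simp: Suc_le_eq)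
  have eq: "(1 + int x * int p) * (1 + int y * int p) = int a * int p ^ 3 + 1"
    using arg_cong[where f = int, OF m] unfolding assms(5) x y by (simp add: algebra_simps)
  have p: "int p > (int a)\<^sup>2 + 2 * int a"
    using assms(4) by (metis of_nat_add of_nat_less_iff of_nat_mult of_nat_numeral of_nat_power)
  \<comment> \<open>The smaller cofactor yields the cube root; which one it is remains open, but
    \<open>eq\<close> is symmetric.\<close>
  have "int a = int y ^ 3 \<or> int a = int x ^ 3"
  proof (cases "y \<le> x")
    case True
    then show ?thesis
      using cube_if_factors_cong_1[OF _ _ _ p eq] pos assms(1) by simp
  next
    case False
    then show ?thesis
      using cube_if_factors_cong_1[OF _ _ _ p eq[unfolded mult.commute[of "1 + int x * int p"]]]
        pos assms(1) by simp
  qed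
  then have "a = y ^ 3 \<or> a = x ^ 3" by (metis of_nat_eq_iff of_nat_power)
  then show False using assms(2) by (auto simp: is_nth_power_def)
qed

end
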